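(* Let $r$ and $\gamma$ be positive integers. Consider the estimation of the parameter $\theta\in(0,1)$ of the Borel-Tanner distribution $p(x|\theta,r)$ under the LINEX loss $L_\gamma$, with an unknown prior $G$ on $(0,1)$. For real numbers $m_n(z|y)\ge 0$ which are estimates (based on the past data) of the marginals $m_G(z|y)=\int_0^1 p(z|\theta,y)\,dG(\theta)$, put, for every integer $x\ge r$, $$\tau_n(x)=\frac{r+\gamma}{r}\left(\frac{x+\gamma}{x}\right)^{x-r-1}\frac{m_n(x|r)}{m_n(x+\gamma|r+\gamma)}.$$ Then $$\theta_n(x)=\begin{cases}\gamma^{-1}\ln\tau_n(x), & \text{if } \tau_n(x)\in(1,e^{\gamma}),\\[2pt] \dfrac{x-r}{x}, & \text{if } \tau_n(x)\notin(1,e^{\gamma}),\end{cases}$$ is a nonparametric empirical Bayes (NPEB) estimator for $\theta$, in the sense defined in the context.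
   Context: Borel-Tanner distribution: for $0<\theta<1$ and a positive integer $r$, $p(x|\theta,r)=a_r(x)\theta^{x-r}e^{-\theta x}$ for $x=r,r+1,\ldots$, where $a_r(x)=r x^{x-r-1}/(x-r)!$. LINEX loss: $L_\gamma(\hat\theta,\theta)=e^{\gamma(\hat\theta-\theta)}-\gamma(\hat\theta-\theta)-1$. Prior and Bayes estimator: $G$ is a probability distribution on $(0,1)$; $\theta$ has distribution $G$ and, conditionally on $\theta$, $X$ has probability mass function $p(\cdot|\theta,r)$. The marginals are $m_G(z|y)=\int_0^1 p(z|\theta,y)\,dG(\theta)$ for integers $z\ge y\ge 1$. The Bayes estimator $\theta_G(x)$ under LINEX loss is the minimizer over $d\in\mathbb{R}$ of the posterior expected loss $E[L_\gamma(d,\theta)\mid X=x]$; equivalently $\theta_G(x)=-\gamma^{-1}\ln E[e^{-\gamma\theta}\mid X=x]$. Empirical Bayes setting: the prior $G$ exists but is unknown and is not restricted to a parametric family. There are past data, obtained from independent unobserved realizations $\theta_1,\ldots,\theta_n$ of $\theta$, from which the estimates $m_n(z|y)$ of the marginals are computed, and a present observation $x$. NPEB estimator (of the direct plug-in type): an estimator $\theta_n(x)$ of the form $\theta_n(x)=T_x\big(m_n(x|r),\,m_n(x+\gamma|r+\gamma)\big)$, where the function $T_x$ does not depend on $G$ and satisfies $T_x\big(m_G(x|r),\,m_G(x+\gamma|r+\gamma)\big)=\theta_G(x)$ for every prior $G$ on $(0,1)$ and every integer $x\ge r$. That is, the Bayes estimator depends on the prior only through these marginals, and $\theta_n(x)$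 is obtained by replacing the marginals with their estimates. Convention: if $m_n(x+\gamma|r+\gamma)=0$, then $\tau_n(x)$ is regarded as not belonging to $(1,e^\gamma)$, so that $\theta_n(x)=(x-r)/x$ (which is the maximum likelihood estimator of $\theta$ based on the single observation $x$). *)

theory Defs
  imports "HOL-Probability.Probability"
begin

text \<open>The exponent \<open>x - r - 1\<close> of the Borel-Tanner coefficient equals \<open>-1\<close> for \<open>x = r\<close>,
  hence the integer power.\<close>

definition bt_coeff :: "nat \<Rightarrow> nat \<Rightarrow> real" where
  "bt_coeff r x = real r * real x powi (int x - int r - 1) / fact (x - r)"

definition borel_tanner :: "nat \<Rightarrow> real \<Rightarrow> nat \<Rightarrow> real" where
  "borel_tanner r \<theta> x =
     (if r \<le> x then bt_coeff r x * \<theta> ^ (x - r) * exp (- \<theta> * real x) else 0)"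

definition linex :: "real \<Rightarrow> real \<Rightarrow> real \<Rightarrow> real" where
  "linex \<gamma> d \<theta> = exp (\<gamma> * (d - \<theta>)) - \<gamma> * (d - \<theta>) - 1"

definition prior :: "real measure \<Rightarrow> bool" where
  "prior G \<longleftrightarrow> prob_space G \<and> sets G = sets (restrict_space borel {0<..<1})"

text \<open>\<open>marginal G z y\<close> is written $m_G(z|y)$ in conventional notation.\<close>

definition marginal :: "real measure \<Rightarrow> nat \<Rightarrow> nat \<Rightarrow> real" where
  "marginal G z y = (LINT \<theta>|G. borel_tanner y \<theta> z)"

text \<open>The joint law of \<open>(\<theta>, X)\<close>: \<open>\<theta>\<close> has law \<open>G\<close> and, given \<open>\<theta>\<close>, \<open>X\<close> has
  mass function \<open>borel_tanner r \<theta>\<close>.\<close>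

definition joint :: "real measure \<Rightarrow> nat \<Rightarrow> (real \<times> nat) measure" where
  "joint G r = density (G \<Otimes>\<^sub>M count_space UNIV) (\<lambda>(\<theta>, x). ennreal (borel_tanner r \<theta> x))"

text \<open>\<open>uniform_measure M A\<close> is the conditional law of \<open>M\<close> given the event \<open>A\<close>,
  so this is the expectation of the loss given \<open>X = x\<close>.\<close>

definition posterior_risk :: "real measure \<Rightarrow> nat \<Rightarrow> real \<Rightarrow> nat \<Rightarrow> real \<Rightarrow> real" where
  "posterior_risk G r \<gamma> x d =
     (LINT \<omega>|uniform_measure (joint G r) {\<omega> \<in> space (joint G r). snd \<omega> = x}.
        linex \<gamma> d (fst \<omega>))"

definition bayes_estimator :: "real measure \<Rightarrow> nat \<Rightarrow> real \<Rightarrow> nat \<Rightarrow> real" where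
  "bayes_estimator G r \<gamma> x = (THE d. is_arg_min (posterior_risk G r \<gamma> x) (\<lambda>_. True) d)"

text \<open>An empirical Bayes rule \<open>est\<close> maps the array \<open>m\<close> of estimated marginals, \<open>m z y\<close>
  estimating \<open>marginal G z y\<close>, and the present observation to an estimate of \<open>\<theta>\<close>. The past
  data enter only through \<open>m\<close>, which ranges over all nonnegative arrays; the plug-in function
  \<open>T\<close> is fixed before both the array and the prior.\<close>

definition NPEB_estimator :: "nat \<Rightarrow> nat \<Rightarrow> ((nat \<Rightarrow> nat \<Rightarrow> real) \<Rightarrow> nat \<Rightarrow> real) \<Rightarrow> bool" where
  "NPEB_estimator r \<gamma> est \<longleftrightarrow>
     (\<exists>T :: nat \<Rightarrow> real \<Rightarrow> real \<Rightarrow> real.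
        (\<forall>m. (\<forall>z y. 1 \<le> y \<and> y \<le> z \<longrightarrow> 0 \<le> m z y) \<longrightarrow>
           (\<forall>x\<ge>r. est m x = T x (m x r) (m (x + \<gamma>) (r + \<gamma>)))) \<and>
        (\<forall>G. prior G \<longrightarrow>
           (\<forall>x\<ge>r. T x (marginal G x r) (marginal G (x + \<gamma>) (r + \<gamma>))
                    = bayes_estimator G r (real \<gamma>) x)))"

text \<open>If the denominator \<open>m (x + \<gamma>) (r + \<gamma>)\<close> vanishes then \<open>tau_n\<close> is \<open>0\<close> because
  division by zero yields \<open>0\<close>; in particular it then lies outside \<open>(1, e\<^sup>\<gamma>)\<close>.\<close>

definition tau_n :: "nat \<Rightarrow> nat \<Rightarrow> (nat \<Rightarrow> nat \<Rightarrow> real) \<Rightarrow> nat \<Rightarrow> real" where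
  "tau_n r \<gamma> m x =
     (real r + real \<gamma>) / real r * ((real x + real \<gamma>) / real x) powi (int x - int r - 1)
       * (m x r / m (x + \<gamma>) (r + \<gamma>))"

definition theta_n :: "nat \<Rightarrow> nat \<Rightarrow> (nat \<Rightarrow> nat \<Rightarrow> real) \<Rightarrow> nat \<Rightarrow> real" where
  "theta_n r \<gamma> m x =
     (if tau_n r \<gamma> m x \<in> {1<..<exp (real \<gamma>)} then ln (tau_n r \<gamma> m x) / real \<gamma>
      else (real x - real r) / real x)"

end

theory Submission imports Defs begin

text \<open>The posterior law of \<open>\<theta>\<close> given \<open>X = x\<close> again lives on \<open>(0,1)\<close>, so
  \<open>E = E[e\<^bsup>-\<gamma>\<theta>\<^esup> | X = x]\<close> lies in \<open>(e\<^bsup>-\<gamma>\<^esup>, 1)\<close>. The posterior risk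
  \<open>e\<^bsup>\<gamma>d\<^esup> E - \<gamma>d\<close>, up to a constant, has the unique minimizer \<open>d = -ln E / \<gamma>\<close>.
  Since \<open>p(x+\<gamma> | \<theta>, r+\<gamma>)\<close> is \<open>e\<^bsup>-\<gamma>\<theta>\<^esup> p(x | \<theta>, r)\<close> up to the ratio of the
  coefficients, \<open>tau_n\<close> evaluated at the true marginals is \<open>1 / E\<close>.\<close>

section \<open>Integration against a law on the unit interval\<close>

lemma prior_space: "prior G \<Longrightarrow> space G = {0<..<1}"
  using sets_eq_imp_space_eq[of G "restrict_space borel {0<..<1}"]
  by (simp add: prior_def space_restrict_space)

lemma prior_measurable:
  assumes "prior G" "f \<in> borel_measurable borel"
  shows "f \<in> borel_measurable G"
  using assms measurable_restrict_space1[OF assms(2), of "{0<..<1}"]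
  by (simp add: prior_def cong: measurable_cong_sets)

text \<open>A bound on (0,1) suffices because that interval is the whole space of
  \<open>G\<close>.\<close>

lemma prior_integrable:
  fixes f :: "real \<Rightarrow> real"
  assumes "prior G" "f \<in> borel_measurable borel" "\<And>\<theta>. 0 < \<theta> \<Longrightarrow> \<theta> < 1 \<Longrightarrow> \<bar>f \<theta>\<bar> \<le> B"
  shows "integrable G f"
proof -
  interpret prob_space G using assms(1) by (simp add: prior_def)
  show ?thesis
    by (rule integrable_const_bound[where B = B])
      (use assms prior_measurable prior_space[OF assms(1)] in \<open>auto intro!: AE_I2\<close>)
qed

lemma prior_exp_integrable:
  assumes "prior G" "\<gamma> > 0"
  shows "integrable G (\<lambda>\<theta>. exp (- \<gamma> * \<theta>))"
  by (rule prior_integrable[where B = 1]) (use assms in auto)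

text \<open>The integrand satisfies both strict bounds at every point of (0,1), and strictness
  survives integration against a probability measure.\<close>

lemma prior_exp_bounds:
  assumes "prior G" "\<gamma> > 0"
  shows "exp (- \<gamma>) < (LINT \<theta>|G. exp (- \<gamma> * \<theta>))" "(LINT \<theta>|G. exp (- \<gamma> * \<theta>)) < 1"
proof -
  interpret prob_space G using assms(1) by (simp add: prior_def)
  note int = prior_exp_integrable[OF assms]
  show "exp (- \<gamma>) < (LINT \<theta>|G. exp (- \<gamma> * \<theta>))"
    by (rule expectation_greater[OF int])
      (use assms prior_space[OF assms(1)] in \<open>auto intro!: AE_I2\<close>)
  show "(LINT \<theta>|G. exp (- \<gamma> * \<theta>)) < 1"
    by (rule expectation_less[OF int])
      (use assms prior_space[OF assms(1)] in \<open>auto intro!: AE_I2\<close>)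
qed

section \<open>Minimizing the LINEX risk\<close>

text \<open>If equality held, y = \<open>exp t\<close> would solve ln y = y - 1, whose only solution
  is y = 1, that is t = 0.\<close>

lemma exp_gt_add_one_self:
  fixes t :: real
  assumes "t \<noteq> 0"
  shows "1 + t < exp t"
  using exp_ge_add_one_self[of t] ln_eq_minus_one[of "exp t"] assms
  by (auto simp: less_le)

text \<open>The minimum must be shown to be strict, since \<open>THE\<close> denotes the minimizer
  only if it is unique.\<close>

lemma linex_risk_arg_min:
  assumes "prior G" "\<gamma> > 0"
  shows "(THE d. is_arg_min (\<lambda>d. LINT \<theta>|G. linex \<gamma> d \<theta>) (\<lambda>_. True) d)
    = - ln (LINT \<theta>|G. exp (- \<gamma> * \<theta>)) / \<gamma>"
proof -
  interpret prob_space G using assms(1) by (simp add: prior_def)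
  define E where "E = (LINT \<theta>|G. exp (- \<gamma> * \<theta>))"
  define d0 where "d0 = - ln E / \<gamma>"
  define \<mu> where "\<mu> = (LINT \<theta>|G. \<theta>)"
  have "E > 0"
    using prior_exp_bounds(1)[OF assms] less_trans[OF exp_gt_zero] unfolding E_def by blast
  \<comment> \<open>Writing \<open>E\<close> as an exponential merges it with the factor
    \<open>exp (\<gamma> * d)\<close>, so the risk depends on \<open>d - d0\<close> up to a linear
    term.\<close>
  then have E: "E = exp (- \<gamma> * d0)"
    using assms(2) by (simp add: d0_def)
  have i1: "integrable G (\<lambda>\<theta>. exp (- \<gamma> * \<theta>))"
    by (rule prior_exp_integrable[OF assms])
  have i2: "integrable G (\<lambda>\<theta>. \<theta>)"
    by (rule prior_integrable[where B = 1]) (use assms in auto)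
  have risk: "(LINT \<theta>|G. linex \<gamma> d \<theta>) = exp (\<gamma> * (d - d0)) - \<gamma> * d + \<gamma> * \<mu> - 1" for d
  proof -
    have "linex \<gamma> d = (\<lambda>\<theta>. exp (\<gamma> * d) * exp (- \<gamma> * \<theta>) + \<gamma> * \<theta> - (\<gamma> * d + 1))"
      by (auto simp: linex_def algebra_simps fun_eq_iff simp flip: exp_add)
    then have "(LINT \<theta>|G. linex \<gamma> d \<theta>) = exp (\<gamma> * d) * E + \<gamma> * \<mu> - (\<gamma> * d + 1)"
      using i1 i2 by (simp add: E_def \<mu>_def prob_space)
    then show ?thesis
      by (simp add: E algebra_simps flip: exp_add)
  qed
  \<comment> \<open>With t = \<open>\<gamma> * (d - d0)\<close>, the risk at \<open>d\<close>
    exceeds the risk at \<open>d0\<close> by \<open>exp t - 1 - t\<close>.\<close>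
  have less: "(LINT \<theta>|G. linex \<gamma> d0 \<theta>) < (LINT \<theta>|G. linex \<gamma> d \<theta>)" if "d \<noteq> d0" for d
    using exp_gt_add_one_self[of "\<gamma> * (d - d0)"] that assms(2)
    by (simp add: risk algebra_simps)
  have "(THE d. is_arg_min (\<lambda>d. LINT \<theta>|G. linex \<gamma> d \<theta>) (\<lambda>_. True) d) = d0"
  proof (rule the_equality)
    show "is_arg_min (\<lambda>d. LINT \<theta>|G. linex \<gamma> d \<theta>) (\<lambda>_. True) d0"
      unfolding is_arg_min_def using less by (metis less_asym)
  next
    fix d assume "is_arg_min (\<lambda>d. LINT \<theta>|G. linex \<gamma> d \<theta>) (\<lambda>_. True) d"
    then show "d = d0"
      unfolding is_arg_min_def using less by blast
  qed
  then show ?thesis by (simp add: d0_def E_def)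
qed

section \<open>Borel-Tanner mass function and its marginals\<close>

lemma bt_coeff_pos: "1 \<le> r \<Longrightarrow> r \<le> x \<Longrightarrow> 0 < bt_coeff r x"
  by (simp add: bt_coeff_def)

lemma borel_tanner_nonneg: "0 \<le> \<theta> \<Longrightarrow> 0 \<le> borel_tanner r \<theta> x"
  by (simp add: borel_tanner_def bt_coeff_def)

lemma borel_tanner_measurable: "(\<lambda>\<theta>. borel_tanner r \<theta> x) \<in> borel_measurable borel"
  unfolding borel_tanner_def by measurable

lemma borel_tanner_integrable:
  assumes "prior G"
  shows "integrable G (\<lambda>\<theta>. borel_tanner r \<theta> x)"
proof (rule prior_integrable[OF assms borel_tanner_measurable, where B = "bt_coeff r x"])
  fix \<theta> :: real
  assume \<theta>: "0 < \<theta>" "\<theta> < 1"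
  have c: "0 \<le> bt_coeff r x" by (simp add: bt_coeff_def)
  have "\<theta> ^ (x - r) * exp (- \<theta> * real x) \<le> 1 * 1"
    by (rule mult_mono) (use \<theta> in \<open>auto intro: power_le_one\<close>)
  then have "bt_coeff r x * (\<theta> ^ (x - r) * exp (- \<theta> * real x)) \<le> bt_coeff r x"
    using c mult_left_mono by fastforce
  then show "\<bar>borel_tanner r \<theta> x\<bar> \<le> bt_coeff r x"
    using \<theta> c by (simp add: borel_tanner_def mult.assoc)
qed

text \<open>The mass function is strictly positive on all of (0,1). Hence the event X = x has
  positive probability and the posterior density is well defined.\<close>

lemma marginal_pos:
  assumes "prior G" "1 \<le> r" "r \<le> x"
  shows "0 < marginal G x r"
proof -
  interpret prob_space G using assms(1) by (simp add: prior_def)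
  show ?thesis
    unfolding marginal_def
    by (rule expectation_greater[OF borel_tanner_integrable[OF assms(1)]])
      (use assms prior_space[OF assms(1)] bt_coeff_pos[OF assms(2,3)] in
        \<open>auto intro!: AE_I2 simp: borel_tanner_def\<close>)
qed

section \<open>The posterior law\<close>

text \<open>Bayes' formula, set up as a law of \<theta> alone rather than of the pair, so that it
  can serve as a prior in its own right.\<close>

definition posterior :: "real measure \<Rightarrow> nat \<Rightarrow> nat \<Rightarrow> real measure" where
  "posterior G r x = density G (\<lambda>\<theta>. ennreal (borel_tanner r \<theta> x / marginal G x r))"

lemma marginal_nn_integral:
  assumes "prior G"
  shows "(\<integral>\<^sup>+\<theta>. ennreal (borel_tanner r \<theta> x) \<partial>G) = ennreal (marginal G x r)"
  unfolding marginal_def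
  by (rule nn_integral_eq_integral[OF borel_tanner_integrable[OF assms]])
    (use prior_space[OF assms] in \<open>auto intro!: AE_I2 borel_tanner_nonneg\<close>)

text \<open>The marginal is exactly the normalizing constant, and a density keeps the sigma-algebra
  of \<open>G\<close>. All results on priors thereby carry over to the posterior.\<close>

lemma posterior_prior:
  assumes "prior G" "1 \<le> r" "r \<le> x"
  shows "prior (posterior G r x)"
proof -
  note M = marginal_pos[OF assms]
  have meas: "(\<lambda>\<theta>. borel_tanner r \<theta> x) \<in> borel_measurable G"
    by (rule prior_measurable[OF assms(1) borel_tanner_measurable])
  have "emeasure (posterior G r x) (space (posterior G r x))
      = (\<integral>\<^sup>+\<theta>. ennreal (borel_tanner r \<theta> x / marginal G x r) \<partial>G)"
    unfolding posterior_def using meas by (simp add: emeasure_density)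
  also have "\<dots> = (\<integral>\<^sup>+\<theta>. ennreal (borel_tanner r \<theta> x) / ennreal (marginal G x r) \<partial>G)"
    by (rule nn_integral_cong)
      (use M prior_space[OF assms(1)] in \<open>auto intro!: divide_ennreal[symmetric] borel_tanner_nonneg\<close>)
  also have "\<dots> = 1"
    using meas M by (simp add: nn_integral_divide marginal_nn_integral[OF assms(1)])
  finally have "prob_space (posterior G r x)"
    by (rule prob_spaceI)
  then show ?thesis
    using assms(1) by (simp add: prior_def posterior_def)
qed

lemma posterior_integral:
  fixes f :: "real \<Rightarrow> real"
  assumes "prior G" "1 \<le> r" "r \<le> x" "f \<in> borel_measurable borel"
  shows "(LINT \<theta>|posterior G r x. f \<theta>)
    = (LINT \<theta>|G. borel_tanner r \<theta> x * f \<theta>) / marginal G x r"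
proof -
  have "(LINT \<theta>|posterior G r x. f \<theta>)
      = (LINT \<theta>|G. (borel_tanner r \<theta> x / marginal G x r) *\<^sub>R f \<theta>)"
    unfolding posterior_def
  proof (rule integral_density)
    show "AE \<theta> in G. 0 \<le> borel_tanner r \<theta> x / marginal G x r"
      using prior_space[OF assms(1)] marginal_pos[OF assms(1-3)]
      by (auto intro!: AE_I2 divide_nonneg_pos borel_tanner_nonneg)
    show "f \<in> borel_measurable G"
      by (rule prior_measurable[OF assms(1,4)])
    show "(\<lambda>\<theta>. borel_tanner r \<theta> x / marginal G x r) \<in> borel_measurable G"
      by (intro borel_measurable_divide prior_measurable[OF assms(1) borel_tanner_measurable]) simp
  qed
  then show ?thesis by simp
qed

section \<open>Conditioning the joint law on X = x\<close>

text \<open>By Tonelli the joint integral is iterated, and on the slice the inner sum over the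
  second coordinate has a single term.\<close>

lemma joint_slice_nn_integral:
  assumes "prior G" "h \<in> borel_measurable (G \<Otimes>\<^sub>M count_space UNIV)"
  shows "(\<integral>\<^sup>+\<omega>. h \<omega> * indicator {\<omega>. snd \<omega> = x} \<omega> \<partial>joint G r)
    = (\<integral>\<^sup>+\<theta>. ennreal (borel_tanner r \<theta> x) * h (\<theta>, x) \<partial>G)"
proof -
  interpret C: sigma_finite_measure "count_space (UNIV :: nat set)"
    by (rule sigma_finite_measure_count_space)
  have bt: "(\<lambda>(\<theta>, y). ennreal (borel_tanner r \<theta> y))
      \<in> borel_measurable (G \<Otimes>\<^sub>M count_space UNIV)"
    \<comment> \<open>The second coordinate is countable, so joint measurability reduces to
      measurability in \<theta> for each fixed value of it.\<close>
    unfolding case_prod_beta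
    by (intro measurable_compose_countable'[where I = UNIV and g = snd
        and f = "\<lambda>y \<omega>. ennreal (borel_tanner r (fst \<omega>) y)"])
      (use prior_measurable[OF assms(1) borel_tanner_measurable] in
        \<open>auto intro!: measurable_compose[OF measurable_fst]\<close>)
  have ind: "indicator {\<omega>. snd \<omega> = x} \<in> borel_measurable (G \<Otimes>\<^sub>M count_space (UNIV :: nat set))"
    for x :: nat
    by measurable
  have "(\<integral>\<^sup>+\<omega>. h \<omega> * indicator {\<omega>. snd \<omega> = x} \<omega> \<partial>joint G r)
      = (\<integral>\<^sup>+\<omega>. (case \<omega> of (\<theta>, y) \<Rightarrow> ennreal (borel_tanner r \<theta> y))
          * (h \<omega> * indicator {\<omega>. snd \<omega> = x} \<omega>) \<partial>(G \<Otimes>\<^sub>M count_space UNIV))"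
    unfolding joint_def by (rule nn_integral_density[OF bt]) (use assms(2) ind in measurable)
  also have "\<dots> = (\<integral>\<^sup>+\<theta>. \<integral>\<^sup>+y. ennreal (borel_tanner r \<theta> y)
          * (h (\<theta>, y) * indicator {\<omega>. snd \<omega> = x} (\<theta>, y)) \<partial>count_space UNIV \<partial>G)"
    by (subst C.nn_integral_fst[symmetric]) (use bt assms(2) ind in \<open>simp_all add: borel_measurable_times_ennreal\<close>)
  also have "\<dots> = (\<integral>\<^sup>+\<theta>. \<integral>\<^sup>+y. ennreal (borel_tanner r \<theta> x) * h (\<theta>, x) * indicator {x} y
          \<partial>count_space UNIV \<partial>G)"
    by (intro nn_integral_cong) (auto split: split_indicator)
  also have "\<dots> = (\<integral>\<^sup>+\<theta>. ennreal (borel_tanner r \<theta> x) * h (\<theta>, x) \<partial>G)"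
    by (simp add: nn_integral_cmult_indicator)
  finally show ?thesis .
qed

text \<open>Both measures give \<open>B\<close> the integral of the mass function over the section
  of \<open>B\<close> at \<open>x\<close>, divided by the marginal. This links the conditional law
  of the pair to Bayes' formula.\<close>

lemma uniform_measure_joint:
  assumes "prior G" "1 \<le> r" "r \<le> x"
  shows "uniform_measure (joint G r) {\<omega> \<in> space (joint G r). snd \<omega> = x}
    = distr (posterior G r x) (G \<Otimes>\<^sub>M count_space UNIV) (\<lambda>\<theta>. (\<theta>, x))"
    (is "uniform_measure _ ?A = ?D")
proof (rule measure_eqI)
  have sets: "sets (joint G r) = sets (G \<Otimes>\<^sub>M count_space UNIV)"
    by (simp add: joint_def)
  note space = sets_eq_imp_space_eq[OF sets]
  show "sets (uniform_measure (joint G r) ?A) = sets ?D"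
    by (simp add: sets)
  note M = marginal_pos[OF assms]
  have A: "?A \<in> sets (joint G r)"
    unfolding sets space by measurable
  \<comment> \<open>General \<open>B\<close> gives the numerator of the conditional probability; the
    whole space gives its denominator in \<open>eA\<close>.\<close>
  have slice: "emeasure (joint G r) (?A \<inter> B)
      = (\<integral>\<^sup>+\<theta>. ennreal (borel_tanner r \<theta> x) * indicator B (\<theta>, x) \<partial>G)"
    if B: "B \<in> sets (joint G r)" for B
  proof -
    have "emeasure (joint G r) (?A \<inter> B) = (\<integral>\<^sup>+\<omega>. indicator (?A \<inter> B) \<omega> \<partial>joint G r)"
      using A B by (simp add: sets.Int)
    also have "\<dots> = (\<integral>\<^sup>+\<omega>. indicator B \<omega> * indicator {\<omega>. snd \<omega> = x} \<omega> \<partial>joint G r)"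
      by (intro nn_integral_cong) (auto split: split_indicator)
    finally show ?thesis
      using B by (subst (asm) joint_slice_nn_integral[OF assms(1)]) (auto simp: sets)
  qed
  have eA: "emeasure (joint G r) ?A = ennreal (marginal G x r)"
  proof -
    have "emeasure (joint G r) ?A = emeasure (joint G r) (?A \<inter> space (joint G r))"
      by (rule arg_cong[where f = "emeasure _"]) auto
    also have "\<dots> = (\<integral>\<^sup>+\<theta>. ennreal (borel_tanner r \<theta> x) \<partial>G)"
      unfolding slice[OF sets.top]
      by (intro nn_integral_cong) (auto simp: space space_pair_measure)
    finally show ?thesis by (simp add: marginal_nn_integral[OF assms(1)])
  qed
  fix B assume "B \<in> sets (uniform_measure (joint G r) ?A)"
  then have B: "B \<in> sets (joint G r)" by simp
  have meas: "(\<lambda>\<theta>. borel_tanner r \<theta> x) \<in> borel_measurable G"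
    by (rule prior_measurable[OF assms(1) borel_tanner_measurable])
  have pair: "(\<lambda>\<theta>. (\<theta>, x)) \<in> G \<rightarrow>\<^sub>M G \<Otimes>\<^sub>M count_space UNIV" by simp
  have B': "(\<lambda>\<theta>. indicator B (\<theta>, x) :: ennreal) \<in> borel_measurable G"
    using B measurable_compose[OF pair borel_measurable_indicator[of B]] by (simp add: sets)
  have "emeasure (uniform_measure (joint G r) ?A) B
      = (\<integral>\<^sup>+\<theta>. ennreal (borel_tanner r \<theta> x) * indicator B (\<theta>, x) \<partial>G) / ennreal (marginal G x r)"
    using A B by (simp add: slice eA)
  also have "\<dots> = (\<integral>\<^sup>+\<theta>. ennreal (borel_tanner r \<theta> x) * indicator B (\<theta>, x)
      / ennreal (marginal G x r) \<partial>G)"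
    using meas B' by (intro nn_integral_divide[symmetric]) measurable
  also have "\<dots> = (\<integral>\<^sup>+\<theta>. ennreal (borel_tanner r \<theta> x / marginal G x r)
      * indicator ((\<lambda>\<theta>. (\<theta>, x)) -` B \<inter> space G) \<theta> \<partial>G)"
    by (rule nn_integral_cong)
      (use M prior_space[OF assms(1)] in
        \<open>auto simp: divide_ennreal borel_tanner_nonneg split: split_indicator\<close>)
  also have "\<dots> = emeasure (posterior G r x) ((\<lambda>\<theta>. (\<theta>, x)) -` B \<inter> space G)"
    unfolding posterior_def
    using meas measurable_sets[OF pair, of B] B by (subst emeasure_density) (auto simp: sets)
  also have "\<dots> = emeasure ?D B"
    using B by (subst emeasure_distr) (auto simp: posterior_def sets)
  finally show "emeasure (uniform_measure (joint G r) ?A) B = emeasure ?D B" .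
qed

text \<open>The loss sees only the first coordinate, so this is a change of variables along the
  embedding of \<theta> as (\<theta>, x).\<close>

lemma posterior_risk_eq:
  assumes "prior G" "1 \<le> r" "r \<le> x"
  shows "posterior_risk G r \<gamma> x d = (LINT \<theta>|posterior G r x. linex \<gamma> d \<theta>)"
proof -
  have "linex \<gamma> d \<in> borel_measurable borel"
    unfolding linex_def by measurable
  then have "(\<lambda>\<omega>. linex \<gamma> d (fst \<omega>)) \<in> borel_measurable (G \<Otimes>\<^sub>M count_space (UNIV :: nat set))"
    using measurable_compose[OF measurable_fst prior_measurable[OF assms(1)]] by blast
  then show ?thesis
    unfolding posterior_risk_def uniform_measure_joint[OF assms]
    by (subst integral_distr) (auto simp: posterior_def)
qed

section \<open>The Bayes estimator in terms of marginals\<close>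

lemma bayes_estimator_eq:
  assumes "prior G" "1 \<le> r" "r \<le> x" "\<gamma> > 0"
  shows "bayes_estimator G r \<gamma> x = - ln (LINT \<theta>|posterior G r x. exp (- \<gamma> * \<theta>)) / \<gamma>"
  unfolding bayes_estimator_def posterior_risk_eq[OF assms(1-3), abs_def]
  by (rule linex_risk_arg_min[OF posterior_prior[OF assms(1-3)] assms(4)])

text \<open>Adding \<gamma> to both \<open>r\<close> and \<open>x\<close> keeps the power of
  \<theta>, since x - r is unchanged; only the exponential gains a factor.\<close>

lemma borel_tanner_shift:
  assumes "1 \<le> r" "r \<le> x"
  shows "borel_tanner (r + \<gamma>) \<theta> (x + \<gamma>)
    = bt_coeff (r + \<gamma>) (x + \<gamma>) / bt_coeff r x
        * (borel_tanner r \<theta> x * exp (- real \<gamma> * \<theta>))"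
  using assms bt_coeff_pos[OF assms]
  by (simp add: borel_tanner_def algebra_simps flip: exp_add)

text \<open>The factorials agree and cancel, and both powers have the same exponent, which is -1
  when x = r.\<close>

lemma bt_coeff_ratio:
  assumes "1 \<le> r" "r \<le> x"
  shows "bt_coeff (r + \<gamma>) (x + \<gamma>) / bt_coeff r x
    = (real r + real \<gamma>) / real r * ((real x + real \<gamma>) / real x) powi (int x - int r - 1)"
  using assms by (simp add: bt_coeff_def power_int_divide_distrib)

text \<open>The coefficient ratio \<open>k\<close> stands in front of \<open>tau_n\<close> and also
  in the shifted marginal, so it cancels; what is left is the reciprocal of a posterior
  expectation.\<close>

lemma tau_n_marginal:
  assumes "prior G" "1 \<le> r" "r \<le> x"
  shows "tau_n r \<gamma> (\<lambda>z y. marginal G z y) x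
    = 1 / (LINT \<theta>|posterior G r x. exp (- real \<gamma> * \<theta>))"
proof -
  define k where "k = bt_coeff (r + \<gamma>) (x + \<gamma>) / bt_coeff r x"
  have "k > 0"
    using assms by (simp add: k_def bt_coeff_pos)
  moreover have "marginal G (x + \<gamma>) (r + \<gamma>)
      = k * (LINT \<theta>|G. borel_tanner r \<theta> x * exp (- real \<gamma> * \<theta>))"
    unfolding marginal_def borel_tanner_shift[OF assms(2,3)] k_def by simp
  moreover have "tau_n r \<gamma> (\<lambda>z y. marginal G z y) x
      = k * (marginal G x r / marginal G (x + \<gamma>) (r + \<gamma>))"
    unfolding tau_n_def k_def bt_coeff_ratio[OF assms(2,3)] ..
  ultimately show ?thesis
    by (subst posterior_integral[OF assms]) auto
qed

text \<open>At the true marginals \<open>tau_n\<close> is 1 / E with E strictly between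
  \<open>exp (- \<gamma>)\<close> and 1, so the logarithmic branch always applies.\<close>

lemma theta_n_marginal:
  assumes "prior G" "1 \<le> r" "r \<le> x" "1 \<le> \<gamma>"
  shows "theta_n r \<gamma> (\<lambda>z y. marginal G z y) x = bayes_estimator G r (real \<gamma>) x"
proof -
  define E where "E = (LINT \<theta>|posterior G r x. exp (- real \<gamma> * \<theta>))"
  have \<gamma>: "real \<gamma> > 0" using assms(4) by simp
  have E: "exp (- real \<gamma>) < E" "E < 1"
    using prior_exp_bounds[OF posterior_prior[OF assms(1-3)] \<gamma>] by (simp_all add: E_def)
  have "E > 0" using E(1) less_trans[OF exp_gt_zero] by blast
  moreover have "1 / E < exp (real \<gamma>)"
    using E(1) \<open>E > 0\<close> by (simp add: exp_minus field_simps)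
  ultimately have "theta_n r \<gamma> (\<lambda>z y. marginal G z y) x = - ln E / real \<gamma>"
    using E(2) tau_n_marginal[OF assms(1-3), of \<gamma>, folded E_def]
    by (simp add: theta_n_def ln_div)
  then show ?thesis
    by (simp add: bayes_estimator_eq[OF assms(1-3) \<gamma>] E_def)
qed

theorem theorem1:
  fixes r \<gamma> :: nat
  assumes "r \<ge> 1" and "\<gamma> \<ge> 1"
  shows "NPEB_estimator r \<gamma> (theta_n r \<gamma>)"
proof -
  \<comment> \<open>\<open>theta_n\<close> at \<open>x\<close> reads only two entries of the array,
    so an array carrying \<open>a\<close> in row \<open>x\<close> and \<open>b\<close> in all others
    reproduces it. The rows \<open>x\<close> and \<open>x + \<gamma>\<close> differ because \<gamma>
    is at least 1.\<close>
  define T where "T x a b = theta_n r \<gamma> (\<lambda>z y. if z = x then a else b) x" for x a b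
  have T: "theta_n r \<gamma> m x = T x (m x r) (m (x + \<gamma>) (r + \<gamma>))" for m x
    using assms(2) by (simp add: T_def theta_n_def tau_n_def)
  show ?thesis
    unfolding NPEB_estimator_def
  proof (intro exI[of _ T] conjI allI impI)
    show "theta_n r \<gamma> m x = T x (m x r) (m (x + \<gamma>) (r + \<gamma>))" for m x
      by (rule T)
    \<comment> \<open>The identity \<open>T\<close> holds for every array, in particular for the
      array of true marginals.\<close>
    show "T x (marginal G x r) (marginal G (x + \<gamma>) (r + \<gamma>)) = bayes_estimator G r (real \<gamma>) x"
      if "prior G" "r \<le> x" for G x
      using theta_n_marginal[OF that(1) assms(1) that(2) assms(2)] by (simp add: T)
  qed
qed

end
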